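(* Let $\varepsilon > 0$, $\zeta > 0$, $\delta \in (0,1)$, let $s$ be a positive integer, and consider an $s$-stage sampling plan for estimating a real parameter $\theta$, with stage estimators $\widehat{\boldsymbol{\theta}}_\ell$ and confidence limits $L_\ell, U_\ell$ ($\ell = 1, \ldots, s$), as described in the context. Suppose that $\Pr\{L_\ell < \theta < U_\ell\} > 1 - \zeta\delta$ for every $\ell = 1, \ldots, s$. Suppose the stopping rule is that sampling is continued until $$U_\ell - \varepsilon < \widehat{\boldsymbol{\theta}}_\ell < L_\ell + \varepsilon$$ at some stage with index $\ell$, and let $\widehat{\boldsymbol{\theta}}$ be the resulting point estimator of $\theta$, i.e. the stage estimator at the stage at which sampling is terminated. If $s\zeta < 1$ and $\Pr\{U_s - \varepsilon < \widehat{\boldsymbol{\theta}}_s < L_s + \varepsilon\} = 1$, then $$\Pr\{|\widehat{\boldsymbol{\theta}} - \theta| < \varepsilon\} > 1 - \delta.$$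
   Context: Multistage sampling plan: $X$ is a random variable (not necessarily bounded) whose distribution is parameterized by $\theta$, and $X_1, X_2, \ldots$ is a sequence of random samples of $X$. The sampling process is divided into $s$ stages. At stage $\ell$ the samples $X_1, \ldots, X_{\mathbf{n}_\ell}$ are available, where the number $\mathbf{n}_\ell$ may be random, depending on the sampling scheme. For each stage $\ell$, the estimator $\widehat{\boldsymbol{\theta}}_\ell$ of $\theta$, the lower confidence limit $L_\ell$ and the upper confidence limit $U_\ell$ are real-valued random variables that are functions of $X_1, \ldots, X_{\mathbf{n}_\ell}$. A decision variable $\boldsymbol{D}_\ell \in \{0,1\}$, also a function of $X_1, \ldots, X_{\mathbf{n}_\ell}$, is attached to each stage, and sampling is continued until $\boldsymbol{D}_\ell = 1$ for some $\ell$; here $\boldsymbol{D}_\ell = 1$ exactly when the condition in the stopping rule holds at stage $\ell$. Let $\boldsymbol{l}$ denote the index of the stage at which sampling is terminated, i.e. the smallest $\ell$ with $\boldsymbol{D}_\ell = 1$. The point estimator is $\widehat{\boldsymbol{\theta}} = \widehat{\boldsymbol{\theta}}_{\boldsymbol{l}}$. Probabilities are taken under the (fixed) true value $\theta$. *)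

theory Defs
  imports "HOL-Probability.Probability"
begin

definition sample_statistic ::
  "'a measure \<Rightarrow> (nat \<Rightarrow> 'a \<Rightarrow> real) \<Rightarrow> ('a \<Rightarrow> nat) \<Rightarrow> ('a \<Rightarrow> 'b) \<Rightarrow> bool" where
  "sample_statistic M X N Y \<longleftrightarrow>
     (\<exists>g :: real list \<Rightarrow> 'b. \<forall>\<omega>\<in>space M. Y \<omega> = g (map (\<lambda>i. X i \<omega>) [1..<Suc (N \<omega>)]))"

text \<open>
  The measure \<open>M\<close> is the probability under the true parameter value \<open>\<theta>\<close>, and \<open>dist t\<close> is
  the law of the sampled variable when the parameter equals \<open>t\<close>. Samples and stages are
  indexed from 1, so the values at index 0 (and at stages beyond \<open>s\<close>) are irrelevant.
  The numbers \<open>n l\<close>, like the stage variables, describe the plan as if all \<open>s\<close> stages were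
  carried out; whether a stage is actually reached is decided by \<open>D\<close>.
\<close>

locale multistage_sampling_plan = prob_space M
  for M :: "'a measure" +
  fixes dist :: "real \<Rightarrow> real measure"
    and \<theta> :: real
    and X :: "nat \<Rightarrow> 'a \<Rightarrow> real"
    and s :: nat
    and n :: "nat \<Rightarrow> 'a \<Rightarrow> nat"
    and T L U :: "nat \<Rightarrow> 'a \<Rightarrow> real"
    and D :: "nat \<Rightarrow> 'a \<Rightarrow> nat"
  assumes samples_indep: "indep_vars (\<lambda>_. borel) X {1..}"
    and samples_distr: "\<And>i. i \<ge> 1 \<Longrightarrow> distr M borel (X i) = dist \<theta>"
    and sample_size_rv: "\<And>l. l \<in> {1..s} \<Longrightarrow> n l \<in> M \<rightarrow>\<^sub>M count_space UNIV"
    and estimator_rv: "\<And>l. l \<in> {1..s} \<Longrightarrow> T l \<in> borel_measurable M"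
    and lower_limit_rv: "\<And>l. l \<in> {1..s} \<Longrightarrow> L l \<in> borel_measurable M"
    and upper_limit_rv: "\<And>l. l \<in> {1..s} \<Longrightarrow> U l \<in> borel_measurable M"
    and decision_rv: "\<And>l. l \<in> {1..s} \<Longrightarrow> D l \<in> M \<rightarrow>\<^sub>M count_space UNIV"
    and estimator_statistic: "\<And>l. l \<in> {1..s} \<Longrightarrow> sample_statistic M X (n l) (T l)"
    and lower_limit_statistic: "\<And>l. l \<in> {1..s} \<Longrightarrow> sample_statistic M X (n l) (L l)"
    and upper_limit_statistic: "\<And>l. l \<in> {1..s} \<Longrightarrow> sample_statistic M X (n l) (U l)"
    and decision_statistic: "\<And>l. l \<in> {1..s} \<Longrightarrow> sample_statistic M X (n l) (D l)"
    and decision_values: "\<And>l \<omega>. l \<in> {1..s} \<Longrightarrow> \<omega> \<in> space M \<Longrightarrow> D l \<omega> \<in> {0, 1}"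

text \<open>
  An \<open>s\<close>-stage plan has no stage after \<open>s\<close>: on outcomes where no decision variable equals 1,
  sampling ends at stage \<open>s\<close>. Without this clause the estimator would be an unspecified,
  possibly non-measurable function on those outcomes.
\<close>

definition termination_stage :: "nat \<Rightarrow> (nat \<Rightarrow> 'a \<Rightarrow> nat) \<Rightarrow> 'a \<Rightarrow> nat" where
  "termination_stage s D \<omega> =
     (if \<exists>l\<in>{1..s}. D l \<omega> = 1 then LEAST l. l \<in> {1..s} \<and> D l \<omega> = 1 else s)"

definition plan_estimator ::
  "nat \<Rightarrow> (nat \<Rightarrow> 'a \<Rightarrow> nat) \<Rightarrow> (nat \<Rightarrow> 'a \<Rightarrow> real) \<Rightarrow> 'a \<Rightarrow> real" where
  "plan_estimator s D T \<omega> = T (termination_stage s D \<omega>) \<omega>"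

end

theory Submission imports Defs begin

text \<open>
  The last stage almost surely meets the stopping condition, so almost surely
  \<open>U - \<epsilon> < T < L + \<epsilon>\<close> holds at the stage where sampling ends. If in addition all \<open>s\<close>
  confidence intervals contain \<open>\<theta>\<close>, this forces \<open>\<theta> - \<epsilon> < T < \<theta> + \<epsilon>\<close> there. A union bound
  over the stages, rather than an analysis of the random terminal stage, controls the
  probability that some interval misses \<open>\<theta>\<close>: it is at most \<open>s \<zeta> \<delta> < \<delta>\<close>.
\<close>

lemma termination_stage_in:
  assumes "s > 0"
  shows "termination_stage s D \<omega> \<in> {1..s}"
proof (cases "\<exists>l\<in>{1..s}. D l \<omega> = 1")
  case True
  then have "\<exists>l. l \<in> {1..s} \<and> D l \<omega> = 1" by blast
  from LeastI_ex[OF this] True show ?thesis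
    by (simp add: termination_stage_def)
qed (use assms in \<open>auto simp: termination_stage_def\<close>)

text \<open>A single positive decision rules out the default branch of
  \<open>termination_stage\<close>, so the stage is a genuine \<open>LEAST\<close> and inherits the
  property it minimizes.\<close>

lemma decision_termination_stage:
  assumes "l \<in> {1..s}" and "D l \<omega> = 1"
  shows "D (termination_stage s D \<omega>) \<omega> = 1"
proof -
  have ex: "\<exists>l. l \<in> {1..s} \<and> D l \<omega> = 1" using assms by blast
  have "termination_stage s D \<omega> = (LEAST l. l \<in> {1..s} \<and> D l \<omega> = 1)"
    using assms unfolding termination_stage_def by auto
  with LeastI_ex[OF ex] show ?thesis by simp
qed

lemma measurable_termination_stage:
  assumes "\<And>l. l \<in> {1..s} \<Longrightarrow> D l \<in> M \<rightarrow>\<^sub>M count_space UNIV"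
  shows "termination_stage s D \<in> M \<rightarrow>\<^sub>M count_space UNIV"
proof -
  \<comment> \<open>\<open>measurable_Least\<close> asks for measurability at every natural number,
    but \<open>D l\<close> is only known to be measurable for \<open>l\<close> in
    \<open>{1..s}\<close>. Elsewhere the predicate is constantly false.\<close>
  have *: "Measurable.pred M (\<lambda>\<omega>. l \<in> {1..s} \<and> D l \<omega> = 1)" for l
  proof (cases "l \<in> {1..s}")
    case True
    note [measurable] = assms[OF True]
    show ?thesis by measurable
  next
    case False
    then have "(\<lambda>\<omega>. l \<in> {1..s} \<and> D l \<omega> = 1) = (\<lambda>\<omega>. False)" by blast
    then show ?thesis by (simp only: measurable_const space_count_space UNIV_I)
  qed
  have "Measurable.pred M (\<lambda>\<omega>. \<exists>l. l \<in> {1..s} \<and> D l \<omega> = 1)"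
    by (rule pred_intros_countable(2)) (rule *)
  moreover have "(\<lambda>\<omega>. LEAST l. l \<in> {1..s} \<and> D l \<omega> = 1) \<in> M \<rightarrow>\<^sub>M count_space UNIV"
    by (rule measurable_Least) (rule *)
  ultimately show ?thesis
    unfolding termination_stage_def[abs_def] Bex_def
    by (intro measurable_If) (simp_all only: pred_def measurable_const space_count_space UNIV_I)
qed

text \<open>A family of measurable functions evaluated at a measurable index with countable range is
  measurable. This makes the success event measurable, as the complement rule in the union bound
  requires.\<close>

lemma borel_measurable_plan_estimator:
  assumes "s > 0"
    and "\<And>l. l \<in> {1..s} \<Longrightarrow> D l \<in> M \<rightarrow>\<^sub>M count_space UNIV"
    and "\<And>l. l \<in> {1..s} \<Longrightarrow> T l \<in> borel_measurable M"
  shows "plan_estimator s D T \<in> borel_measurable M"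
proof -
  \<comment> \<open>The index space is narrowed to \<open>{1..s}\<close> because \<open>T l\<close>
    is known to be measurable only there.\<close>
  have "termination_stage s D \<in> M \<rightarrow>\<^sub>M count_space {1..s}"
    using measurable_termination_stage[of s D M, OF assms(2)]
      termination_stage_in[OF assms(1), of D]
    by (auto simp: measurable_count_space_eq2_countable simp del: atLeastAtMost_iff)
  from measurable_compose_countable'[where f = T, OF assms(3) this] show ?thesis
    by (simp add: plan_estimator_def[abs_def])
qed

text \<open>Up to a null set, failure of \<open>Q\<close> forces failure of some \<open>P i\<close>,
  and each of these failures has probability below \<open>c\<close>. Independence of the
  \<open>P i\<close> plays no part.\<close>

lemma (in prob_space) prob_union_bound:
  fixes c :: real
  assumes "finite I" and "I \<noteq> {}"
    and "\<And>i. i \<in> I \<Longrightarrow> {\<omega> \<in> space M. P i \<omega>} \<in> events"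
    and "{\<omega> \<in> space M. Q \<omega>} \<in> events"
    and "\<And>i. i \<in> I \<Longrightarrow> \<P>(\<omega> in M. P i \<omega>) > 1 - c"
    and "AE \<omega> in M. (\<forall>i\<in>I. P i \<omega>) \<longrightarrow> Q \<omega>"
  shows "\<P>(\<omega> in M. Q \<omega>) > 1 - card I * c"
proof -
  have neg: "{\<omega> \<in> space M. \<not> P i \<omega>} \<in> events" if "i \<in> I" for i
    using assms(3)[OF that] by (rule sets.sets_Collect_neg)
  have "1 - \<P>(\<omega> in M. Q \<omega>) = \<P>(\<omega> in M. \<not> Q \<omega>)"
    using prob_neg[OF assms(4)] by simp
  also have "\<dots> \<le> prob (\<Union>i\<in>I. {\<omega> \<in> space M. \<not> P i \<omega>})"
    by (rule finite_measure_mono_AE) (use assms(1,6) neg in auto)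
  also have "\<dots> \<le> (\<Sum>i\<in>I. \<P>(\<omega> in M. \<not> P i \<omega>))"
    by (rule finite_measure_subadditive_finite) (use assms(1) neg in auto)
  \<comment> \<open>Strictness survives summation because \<open>I\<close> is finite and
    nonempty.\<close>
  also have "\<dots> < (\<Sum>i\<in>I. c)"
  proof (rule sum_strict_mono[OF assms(1,2)])
    show "\<P>(\<omega> in M. \<not> P i \<omega>) < c" if "i \<in> I" for i
      using prob_neg[OF assms(3)[OF that]] assms(5)[OF that] by simp
  qed
  finally show ?thesis by simp
qed

theorem theorem2:
  fixes M :: "'a measure"
    and dist :: "real \<Rightarrow> real measure"
    and X :: "nat \<Rightarrow> 'a \<Rightarrow> real"
    and n D :: "nat \<Rightarrow> 'a \<Rightarrow> nat"
    and T L U :: "nat \<Rightarrow> 'a \<Rightarrow> real"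
    and s :: nat
    and \<theta> \<epsilon> \<zeta> \<delta> :: real
  assumes "\<epsilon> > 0" and "\<zeta> > 0" and "0 < \<delta>" and "\<delta> < 1" and "s > 0"
    and plan: "multistage_sampling_plan M dist \<theta> X s n T L U D"
    and coverage: "\<And>l. l \<in> {1..s} \<Longrightarrow>
      \<P>(\<omega> in M. L l \<omega> < \<theta> \<and> \<theta> < U l \<omega>) > 1 - \<zeta> * \<delta>"
    and stopping_rule: "\<And>l \<omega>. l \<in> {1..s} \<Longrightarrow> \<omega> \<in> space M \<Longrightarrow>
      D l \<omega> = 1 \<longleftrightarrow> U l \<omega> - \<epsilon> < T l \<omega> \<and> T l \<omega> < L l \<omega> + \<epsilon>"
    and "real s * \<zeta> < 1"
    and last_stage: "\<P>(\<omega> in M. U s \<omega> - \<epsilon> < T s \<omega> \<and> T s \<omega> < L s \<omega> + \<epsilon>) = 1"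
  shows "\<P>(\<omega> in M. \<bar>plan_estimator s D T \<omega> - \<theta>\<bar> < \<epsilon>) > 1 - \<delta>"
proof -
  interpret multistage_sampling_plan M dist \<theta> X s n T L U D by (rule plan)
  note [measurable] = borel_measurable_plan_estimator[OF \<open>s > 0\<close> decision_rv estimator_rv]
  have "AE \<omega> in M. U s \<omega> - \<epsilon> < T s \<omega> \<and> T s \<omega> < L s \<omega> + \<epsilon>"
    using AE_prob_1[OF last_stage] by auto
  moreover have "\<bar>plan_estimator s D T \<omega> - \<theta>\<bar> < \<epsilon>"
    if "\<omega> \<in> space M" "U s \<omega> - \<epsilon> < T s \<omega> \<and> T s \<omega> < L s \<omega> + \<epsilon>"
      "\<forall>l\<in>{1..s}. L l \<omega> < \<theta> \<and> \<theta> < U l \<omega>" for \<omega>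
  proof -
    define t where "t = termination_stage s D \<omega>"
    have t: "t \<in> {1..s}" using termination_stage_in[OF \<open>s > 0\<close>] by (simp add: t_def)
    \<comment> \<open>Stopping at stage \<open>s\<close> excludes outcomes on which sampling ends
      there by default without meeting the stopping condition.\<close>
    have "D s \<omega> = 1" using stopping_rule[of s \<omega>] that \<open>s > 0\<close> by auto
    then have "D t \<omega> = 1"
      using decision_termination_stage[of s s D \<omega>] \<open>s > 0\<close> by (simp add: t_def)
    then have "U t \<omega> - \<epsilon> < T t \<omega>" "T t \<omega> < L t \<omega> + \<epsilon>"
      using stopping_rule[OF t] that by auto
    \<comment> \<open>Coverage is assumed at all stages, so it may be used at the random stage
      \<open>t\<close>. Chaining gives \<open>\<theta> - \<epsilon> < U t \<omega> - \<epsilon> < T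
      t \<omega> < L t \<omega> + \<epsilon> < \<theta> + \<epsilon>\<close>.\<close>
    moreover have "L t \<omega> < \<theta>" "\<theta> < U t \<omega>" using that t by auto
    ultimately show ?thesis by (simp add: plan_estimator_def flip: t_def)
  qed
  ultimately have "AE \<omega> in M. (\<forall>l\<in>{1..s}. L l \<omega> < \<theta> \<and> \<theta> < U l \<omega>) \<longrightarrow>
      \<bar>plan_estimator s D T \<omega> - \<theta>\<bar> < \<epsilon>"
    by auto
  moreover have "{\<omega> \<in> space M. L l \<omega> < \<theta> \<and> \<theta> < U l \<omega>} \<in> events" if "l \<in> {1..s}" for l
  proof -
    note [measurable] = lower_limit_rv[OF that] upper_limit_rv[OF that]
    show ?thesis by measurable
  qed
  ultimately have "\<P>(\<omega> in M. \<bar>plan_estimator s D T \<omega> - \<theta>\<bar> < \<epsilon>) > 1 - card {1..s} * (\<zeta> * \<delta>)"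
    using \<open>s > 0\<close> coverage by (intro prob_union_bound[of _ "\<lambda>l \<omega>. L l \<omega> < \<theta> \<and> \<theta> < U l \<omega>"]) auto
  moreover have "real s * \<zeta> * \<delta> < \<delta>"
    using \<open>real s * \<zeta> < 1\<close> \<open>0 < \<delta>\<close> by simp
  ultimately show ?thesis by (simp add: mult.assoc)
qed

end
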